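(* Let $n>1$, let $X=L^{1}(\mathbb{R}^{n};\mathbb{R}^{n})$ be the Banach space of integrable vector fields on $\mathbb{R}^n$, and let $$N=\Bigl\{(f_{j})_{1\le j\le n}\in X:\ \sum_{1\le j\le n}\frac{\partial f_{j}}{\partial x_{j}}=0\text{ in the sense of distributions}\Bigr\}.$$ Then $N$ is not nicely placed, that is, its closed unit ball $B_N=\{F\in N:\ \|F\|_1\le 1\}$ is not closed in $X$ for the topology $\tau_m$ of local convergence in measure.
   Context: $\mathbb{R}^n$ carries the Euclidean norm $|\cdot|$ and Lebesgue measure $m$; $\|F\|_1=\int_{\mathbb{R}^n}|F(x)|\,dx$. The topology $\tau_m$ of local convergence in measure is the (metrizable) vector topology on measurable vector fields for which $F_k\to F$ if and only if for every measurable set $A$ with $m(A)<\infty$ and every $\varepsilon>0$, $m(\{x\in A:\ |F_k(x)-F(x)|>\varepsilon\})\to 0$. A closed subspace of $L^1$ is called nicely placed if its closed unit ball is $\tau_m$-closed. *)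

theory Defs
  imports "HOL-Analysis.Analysis"
begin

text \<open>
  Vector fields are represented by functions rather than by classes modulo equality almost
  everywhere. All sets and topologies below respect that equality (see
  \<open>openin_lm_topology_AE\<close> for the topology), so closedness means the same for the classes.
\<close>

section \<open>The topology of local convergence in measure\<close>

definition lm_nbhd ::
    "(real^'n) set \<Rightarrow> real \<Rightarrow> real \<Rightarrow> (real^'n \<Rightarrow> real^'n) \<Rightarrow> (real^'n \<Rightarrow> real^'n) set"
  where "lm_nbhd A e d F =
    {G \<in> borel_measurable lebesgue. measure lebesgue {x \<in> A. norm (G x - F x) > e} < d}"

definition lm_open :: "(real^'n \<Rightarrow> real^'n) set \<Rightarrow> bool"
  where "lm_open U \<longleftrightarrow> U \<subseteq> borel_measurable lebesgue \<and>
    (\<forall>F\<in>U. \<exists>A\<in>lmeasurable. \<exists>e>0. \<exists>d>0. lm_nbhd A e d F \<subseteq> U)"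

definition lm_topology :: "(real^'n \<Rightarrow> real^'n) topology"
  where "lm_topology = topology lm_open"

lemma lm_set_lmeasurable:
  fixes F G :: "real^'n \<Rightarrow> real^'n"
  assumes "A \<in> lmeasurable" "F \<in> borel_measurable lebesgue" "G \<in> borel_measurable lebesgue"
  shows "{x \<in> A. norm (G x - F x) > e} \<in> lmeasurable"
proof -
  have "(\<lambda>x. norm (G x - F x)) \<in> borel_measurable lebesgue"
    using assms by measurable
  then have "{x \<in> space lebesgue. norm (G x - F x) > e} \<in> sets lebesgue"
    by measurable
  then have "A \<inter> {x. norm (G x - F x) > e} \<in> lmeasurable"
    using assms(1) by (intro fmeasurable_Int_fmeasurable) auto
  moreover have "A \<inter> {x. norm (G x - F x) > e} = {x \<in> A. norm (G x - F x) > e}"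
    by auto
  ultimately show ?thesis by simp
qed

lemma lm_nbhd_mono:
  assumes "F \<in> borel_measurable lebesgue" "B \<in> lmeasurable" "A \<in> lmeasurable"
    and "A \<subseteq> B" "e' \<le> e" "d' \<le> d"
  shows "lm_nbhd B e' d' F \<subseteq> lm_nbhd A e d F"
proof
  fix G assume G: "G \<in> lm_nbhd B e' d' F"
  have "measure lebesgue {x \<in> A. norm (G x - F x) > e}
      \<le> measure lebesgue {x \<in> B. norm (G x - F x) > e'}"
    using G assms unfolding lm_nbhd_def
    by (intro measure_mono_fmeasurable lm_set_lmeasurable fmeasurableD) auto
  then show "G \<in> lm_nbhd A e d F"
    using G assms(6) unfolding lm_nbhd_def by auto
qed

lemma lm_nbhd_trans:
  assumes F: "F \<in> borel_measurable lebesgue" and A: "A \<in> lmeasurable"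
    and H: "H \<in> lm_nbhd A (e/2) (d/2) F"
  shows "lm_nbhd A (e/2) (d/2) H \<subseteq> lm_nbhd A e d F"
proof
  fix G assume G: "G \<in> lm_nbhd A (e/2) (d/2) H"
  let ?P = "{x \<in> A. norm (G x - H x) > e/2}" and ?Q = "{x \<in> A. norm (H x - F x) > e/2}"
  have PQ: "?P \<in> lmeasurable" "?Q \<in> lmeasurable"
    using F G H A unfolding lm_nbhd_def by (blast intro: lm_set_lmeasurable)+
  have "{x \<in> A. norm (G x - F x) > e} \<subseteq> ?P \<union> ?Q"
  proof
    fix x assume x: "x \<in> {x \<in> A. norm (G x - F x) > e}"
    have "norm (G x - F x) \<le> norm (G x - H x) + norm (H x - F x)"
      using norm_triangle_ineq[of "G x - H x" "H x - F x"] by simp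
    with x show "x \<in> ?P \<union> ?Q" by auto
  qed
  then have "measure lebesgue {x \<in> A. norm (G x - F x) > e} \<le> measure lebesgue (?P \<union> ?Q)"
    using F G H A PQ unfolding lm_nbhd_def
    by (intro measure_mono_fmeasurable lm_set_lmeasurable fmeasurableD fmeasurable.Un) auto
  also have "\<dots> \<le> measure lebesgue ?P + measure lebesgue ?Q"
    using PQ by (intro measure_Un_le) auto
  also have "\<dots> < d"
    using G H unfolding lm_nbhd_def by auto
  finally show "G \<in> lm_nbhd A e d F"
    using G unfolding lm_nbhd_def by auto
qed

lemma istopology_lm_open: "istopology lm_open"
  unfolding istopology_def
proof (intro conjI allI impI)
  fix S T :: "(real^'n \<Rightarrow> real^'n) set"
  assume ST: "lm_open S" "lm_open T"
  show "lm_open (S \<inter> T)"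
    unfolding lm_open_def
  proof (intro conjI ballI)
    show "S \<inter> T \<subseteq> borel_measurable lebesgue"
      using ST unfolding lm_open_def by auto
    fix F assume F: "F \<in> S \<inter> T"
    then have Fm: "F \<in> borel_measurable lebesgue"
      using ST unfolding lm_open_def by auto
    obtain A e d where 1: "A \<in> lmeasurable" "e > 0" "d > 0" "lm_nbhd A e d F \<subseteq> S"
      using ST F unfolding lm_open_def by (metis IntD1)
    obtain B e' d' where 2: "B \<in> lmeasurable" "e' > 0" "d' > 0" "lm_nbhd B e' d' F \<subseteq> T"
      using ST F unfolding lm_open_def by (metis IntD2)
    have AB: "A \<union> B \<in> lmeasurable"
      using 1 2 by (intro fmeasurable.Un)
    have "lm_nbhd (A \<union> B) (min e e') (min d d') F \<subseteq> lm_nbhd A e d F"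
      "lm_nbhd (A \<union> B) (min e e') (min d d') F \<subseteq> lm_nbhd B e' d' F"
      using Fm AB 1 2 by (intro lm_nbhd_mono; auto)+
    then show "\<exists>A\<in>lmeasurable. \<exists>e>0. \<exists>d>0. lm_nbhd A e d F \<subseteq> S \<inter> T"
      using AB 1 2 by (intro bexI[of _ "A \<union> B"] exI[of _ "min e e'"] exI[of _ "min d d'"] conjI) auto
  qed
next
  fix K :: "(real^'n \<Rightarrow> real^'n) set set"
  assume K: "\<forall>U\<in>K. lm_open U"
  show "lm_open (\<Union>K)"
    unfolding lm_open_def
  proof (intro conjI ballI)
    show "\<Union>K \<subseteq> borel_measurable lebesgue"
      using K unfolding lm_open_def by blast
    fix F assume "F \<in> \<Union>K"
    then obtain U where U: "U \<in> K" "F \<in> U" by blast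
    then obtain A e d where "A \<in> lmeasurable" "e > 0" "d > 0" "lm_nbhd A e d F \<subseteq> U"
      using K unfolding lm_open_def by metis
    with U show "\<exists>A\<in>lmeasurable. \<exists>e>0. \<exists>d>0. lm_nbhd A e d F \<subseteq> \<Union>K"
      by blast
  qed
qed

lemma openin_lm_topology: "openin lm_topology U \<longleftrightarrow> lm_open U"
  unfolding lm_topology_def by (simp add: topology_inverse'[OF istopology_lm_open])

lemma topspace_lm_topology: "topspace lm_topology = borel_measurable lebesgue"
proof -
  have "lm_open (borel_measurable lebesgue :: (real^'n \<Rightarrow> real^'n) set)"
    unfolding lm_open_def lm_nbhd_def
    by (auto intro!: bexI[of _ "{}"] exI[of _ "1::real"])
  then have "openin lm_topology (borel_measurable lebesgue :: (real^'n \<Rightarrow> real^'n) set)"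
    by (simp add: openin_lm_topology)
  moreover have "topspace lm_topology \<subseteq> (borel_measurable lebesgue :: (real^'n \<Rightarrow> real^'n) set)"
    using openin_topspace[of lm_topology] unfolding openin_lm_topology lm_open_def by blast
  ultimately show ?thesis
    using openin_subset by blast
qed

lemma limitin_lm_topology:
  fixes Fk :: "nat \<Rightarrow> real^'n \<Rightarrow> real^'n" and F :: "real^'n \<Rightarrow> real^'n"
  assumes Fk: "\<And>k. Fk k \<in> borel_measurable lebesgue" and F: "F \<in> borel_measurable lebesgue"
  shows "limitin lm_topology Fk F sequentially \<longleftrightarrow>
    (\<forall>A\<in>lmeasurable. \<forall>e>0.
      (\<lambda>k. measure lebesgue {x \<in> A. norm (Fk k x - F x) > e}) \<longlonglongrightarrow> 0)" (is "?L \<longleftrightarrow> ?R")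
proof
  assume L: ?L
  show ?R
  proof (intro ballI allI impI)
    fix A :: "(real^'n) set" and e :: real assume A: "A \<in> lmeasurable" and e: "e > 0"
    show "(\<lambda>k. measure lebesgue {x \<in> A. norm (Fk k x - F x) > e}) \<longlonglongrightarrow> 0"
    proof (rule tendstoI)
      fix d :: real assume d: "d > 0"
      define V where "V = {G \<in> borel_measurable lebesgue.
        \<exists>A'\<in>lmeasurable. \<exists>e'>0. \<exists>d'>0. lm_nbhd A' e' d' G \<subseteq> lm_nbhd A e d F}"
      have self: "G \<in> lm_nbhd A' e' d' G"
        if "G \<in> borel_measurable lebesgue" "e' > 0" "d' > 0"
        for G :: "real^'n \<Rightarrow> real^'n" and A' e' d'
        using that unfolding lm_nbhd_def by simp
      have "lm_open V"
        unfolding lm_open_def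
      proof (intro conjI ballI)
        show "V \<subseteq> borel_measurable lebesgue" unfolding V_def by blast
        fix G assume G: "G \<in> V"
        then obtain A' e' d' where *: "A' \<in> lmeasurable" "e' > 0" "d' > 0"
          "lm_nbhd A' e' d' G \<subseteq> lm_nbhd A e d F"
          unfolding V_def by blast
        have Gm: "G \<in> borel_measurable lebesgue" using G unfolding V_def by blast
        have "lm_nbhd A' (e'/2) (d'/2) G \<subseteq> V"
        proof
          fix H assume H: "H \<in> lm_nbhd A' (e'/2) (d'/2) G"
          have "lm_nbhd A' (e'/2) (d'/2) H \<subseteq> lm_nbhd A e d F"
            using lm_nbhd_trans[OF Gm *(1) H] *(4) by blast
          moreover have "H \<in> borel_measurable lebesgue" using H unfolding lm_nbhd_def by blast
          moreover have "e'/2 > 0" "d'/2 > 0" using * by auto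
          ultimately show "H \<in> V" using *(1) unfolding V_def by blast
        qed
        moreover have "e'/2 > 0" "d'/2 > 0" using * by auto
        ultimately show "\<exists>A\<in>lmeasurable. \<exists>e>0. \<exists>d>0. lm_nbhd A e d G \<subseteq> V"
          using *(1) by blast
      qed
      moreover have "F \<in> V" using F A e d unfolding V_def by blast
      ultimately have "\<forall>\<^sub>F k in sequentially. Fk k \<in> V"
        using L unfolding limitin_def openin_lm_topology by blast
      then show "\<forall>\<^sub>F k in sequentially.
          dist (measure lebesgue {x \<in> A. norm (Fk k x - F x) > e}) 0 < d"
      proof (rule eventually_mono)
        fix k assume "Fk k \<in> V"
        then have "Fk k \<in> lm_nbhd A e d F"
          using self unfolding V_def by blast
        then show "dist (measure lebesgue {x \<in> A. norm (Fk k x - F x) > e}) 0 < d"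
          unfolding lm_nbhd_def by simp
      qed
    qed
  qed
next
  assume R: ?R
  show ?L
    unfolding limitin_def
  proof (intro conjI allI impI)
    show "F \<in> topspace lm_topology" using F by (simp add: topspace_lm_topology)
    fix U assume "openin lm_topology U \<and> F \<in> U"
    then obtain A e d where *: "A \<in> lmeasurable" "e > 0" "d > 0" "lm_nbhd A e d F \<subseteq> U"
      unfolding openin_lm_topology lm_open_def by blast
    have "\<forall>\<^sub>F k in sequentially. measure lebesgue {x \<in> A. norm (Fk k x - F x) > e} < d"
      using R * by (intro order_tendstoD(2)[where y = 0]) auto
    then show "\<forall>\<^sub>F k in sequentially. Fk k \<in> U"
      by (rule eventually_mono) (use Fk *(4) in \<open>auto simp: lm_nbhd_def\<close>)
  qed
qed

lemma openin_lm_topology_AE: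
  fixes F G :: "real^'n \<Rightarrow> real^'n"
  assumes U: "openin lm_topology U" and F: "F \<in> U"
    and G: "G \<in> borel_measurable lebesgue" and FG: "AE x in lebesgue. G x = F x"
  shows "G \<in> U"
proof -
  obtain A e d where *: "A \<in> lmeasurable" "e > 0" "d > 0" "lm_nbhd A e d F \<subseteq> U"
    using U F unfolding openin_lm_topology lm_open_def by blast
  have Fm: "F \<in> borel_measurable lebesgue"
    using U F unfolding openin_lm_topology lm_open_def by blast
  have "AE x in lebesgue. x \<notin> {x \<in> A. norm (G x - F x) > e}"
    using FG by eventually_elim (use *(2) in auto)
  then have "{x \<in> A. norm (G x - F x) > e} \<in> null_sets lebesgue"
    using AE_iff_null_sets[OF fmeasurableD[OF lm_set_lmeasurable[OF *(1) Fm G]]] by blast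
  then have "measure lebesgue {x \<in> A. norm (G x - F x) > e} = 0"
    by (simp add: measure_def null_sets_def)
  then show ?thesis
    using * G unfolding lm_nbhd_def by auto
qed

section \<open>Distributions\<close>

definition partial_deriv :: "'n \<Rightarrow> (real^'n \<Rightarrow> real) \<Rightarrow> real^'n \<Rightarrow> real"
  where "partial_deriv j \<phi> x = frechet_derivative \<phi> (at x) (axis j 1)"

fun C_k :: "nat \<Rightarrow> (real^'n \<Rightarrow> real) \<Rightarrow> bool"
  where
    "C_k 0 \<phi> \<longleftrightarrow> continuous_on UNIV \<phi>"
  | "C_k (Suc k) \<phi> \<longleftrightarrow> (\<forall>x. \<phi> differentiable at x) \<and> (\<forall>j. C_k k (partial_deriv j \<phi>))"

definition test_functions :: "(real^'n \<Rightarrow> real) set"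
  where "test_functions = {\<phi>. (\<forall>k. C_k k \<phi>) \<and> compact (closure {x. \<phi> x \<noteq> 0})}"

text \<open>Distributions are represented by functionals whose values matter on test functions only.\<close>

definition regular_distribution :: "(real^'n \<Rightarrow> real) \<Rightarrow> (real^'n \<Rightarrow> real) \<Rightarrow> real"
  where "regular_distribution f \<phi> = (\<integral>x. f x * \<phi> x \<partial>lebesgue)"

definition distribution_deriv ::
    "'n \<Rightarrow> ((real^'n \<Rightarrow> real) \<Rightarrow> real) \<Rightarrow> (real^'n \<Rightarrow> real) \<Rightarrow> real"
  where "distribution_deriv j T \<phi> = - T (partial_deriv j \<phi>)"

section \<open>Nicely placed subspaces of the space of integrable vector fields\<close>

definition L1_fields :: "(real^'n \<Rightarrow> real^'n) set"
  where "L1_fields = {F. integrable lebesgue F}"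

definition L1_norm :: "(real^'n \<Rightarrow> real^'n) \<Rightarrow> real"
  where "L1_norm F = (\<integral>x. norm (F x) \<partial>lebesgue)"

definition div_free_fields :: "(real^'n \<Rightarrow> real^'n) set"
  where "div_free_fields = {F \<in> L1_fields. \<forall>\<phi>\<in>test_functions.
    (\<Sum>j\<in>UNIV. distribution_deriv j (regular_distribution (\<lambda>x. F x $ j)) \<phi>) = 0}"

text \<open>
  The notion is meant for \<open>L1\<close>-closed subspaces \<open>S\<close> of \<open>L1_fields\<close>. That requirement is not part
  of the predicate, so its negation says exactly that the closed unit ball is not closed.
\<close>

definition nicely_placed :: "(real^'n \<Rightarrow> real^'n) set \<Rightarrow> bool"
  where "nicely_placed S \<longleftrightarrow>
    closedin (subtopology lm_topology L1_fields) {F \<in> S. L1_norm F \<le> 1}"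

end

theory Submission
  imports Defs
begin

text \<open>
  For distinct coordinates $a$, $b$ the field $u(x_a) v'(x_b) e_a - u'(x_a) v(x_b) e_b$, cut off
  by an indicator in the remaining coordinates, is divergence free for all $C^1$ bumps $u$, $v$.
  Let $v$ run through plateau functions $v_k$ that increase to the indicator of $[0,1]$, with
  flanks of width $1/k$. The first component is of size $k$ on two slabs of measure $1/k$, so the
  $L^1$ norms stay bounded while it vanishes locally in measure. The limit
  $- u'(x_a) 1_{[0,1]}(x_b) e_b$ has lost the return flow along the faces $x_b = 0$ and $x_b = 1$
  and is not divergence free: a radial bump centred on the face $x_b = 1$ detects this.
\<close>

section \<open>Integration by parts in one coordinate\<close>

text \<open>As distributions, the derivatives of v_k tend to the unit mass at 0 minus the unit mass
  at 1, so the first component turns into a current carried by two faces; convergence in measure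
  ignores such concentrated mass. Regularity is spent unevenly. Membership in N asks only for
  integrability and a weak identity, so piecewise quadratic plateaus suffice. Their derivatives are
  kept continuous because integration by parts is derived from pointwise difference quotients with a
  continuous directional derivative. The remaining coordinates are never differentiated, so a
  discontinuous indicator is harmless there. Infinite smoothness is required only of one test
  function, built from exp(-1/t). Its radial shape means that no integral has to be computed to
  refute the limit: the gradient points to the centre, so for x_b < 1 the derivative in direction b
  has one sign, and the indicator of [0,1] removes the opposite half of the ball, whose contribution
  would cancel.\<close>

lemma lborel_integral_translation:
  fixes f :: "'a::euclidean_space \<Rightarrow> real"
  assumes [measurable]: "f \<in> borel_measurable borel"
  shows "(\<integral>x. f (c + x) \<partial>lborel) = (\<integral>x. f x \<partial>lborel)"
proof -
  have "(\<integral>x. f x \<partial>lborel) = (\<integral>x. f x \<partial>distr lborel borel ((+) c))"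
    by (simp add: lborel_distr_plus)
  also have "\<dots> = (\<integral>x. f (c + x) \<partial>lborel)"
    by (subst integral_distr) auto
  finally show ?thesis by simp
qed

lemma continuous_compact_support_bounded:
  fixes f :: "'a::euclidean_space \<Rightarrow> real"
  assumes "continuous_on UNIV f" "\<And>x. norm x > R \<Longrightarrow> f x = 0"
  obtains K where "K \<ge> 0" "\<And>x. \<bar>f x\<bar> \<le> K"
proof -
  have "bounded (f ` cball 0 R)"
    using assms(1) by (intro compact_imp_bounded compact_continuous_image)
      (auto intro: continuous_on_subset)
  then have "\<exists>K. \<forall>x. norm x \<le> R \<longrightarrow> \<bar>f x\<bar> \<le> K"
    by (metis bounded_iff imageI mem_cball_0 real_norm_def)
  then obtain K where K: "\<And>x. norm x \<le> R \<Longrightarrow> \<bar>f x\<bar> \<le> K"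
    by blast
  show thesis
  proof
    show "max K 0 \<ge> 0" by simp
    show "\<bar>f x\<bar> \<le> max K 0" for x
      using K[of x] assms(2)[of x] by (cases "norm x \<le> R") auto
  qed
qed

lemma lborel_integrable_bounded_cball:
  fixes f :: "'a::euclidean_space \<Rightarrow> 'b::{banach, second_countable_topology}"
  assumes "f \<in> borel_measurable borel" "\<And>x. norm (f x) \<le> K" "\<And>x. norm x > R \<Longrightarrow> f x = 0"
  shows "integrable lborel f"
  by (rule integrableI_bounded_set[where A = "cball 0 R" and B = K])
    (use assms emeasure_lborel_cball_finite[of 0 R] in auto)

text \<open>
  The integral of a difference quotient along \<open>e\<close> vanishes by translation invariance; dominated
  convergence then replaces Fubini's theorem, and \<open>g\<close> need not be continuous.
\<close>
lemma has_bochner_integral_directional_derivative: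
  fixes e :: "'a::euclidean_space" and g \<psi> D :: "'a \<Rightarrow> real"
  assumes g[measurable]: "g \<in> borel_measurable borel"
    and g_bd: "\<And>x. \<bar>g x\<bar> \<le> C"
    and g_inv: "\<And>x t. g (x + t *\<^sub>R e) = g x"
    and \<psi>: "continuous_on UNIV \<psi>" and D: "continuous_on UNIV D"
    and deriv: "\<And>x. ((\<lambda>t. \<psi> (x + t *\<^sub>R e)) has_real_derivative D x) (at 0)"
    and supp: "\<And>x. norm x > R \<Longrightarrow> \<psi> x = 0"
  shows "has_bochner_integral lborel (\<lambda>x. g x * D x) 0"
proof -
  have [measurable]: "\<psi> \<in> borel_measurable borel" "D \<in> borel_measurable borel"
    using \<psi> D by (auto intro: borel_measurable_continuous_onI)
  have D_supp: "D x = 0" if "norm x > R" for x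
  proof -
    have "eventually (\<lambda>t. norm (x + t *\<^sub>R e) > R) (nhds (0::real))"
      using that
      by (intro order_tendstoD(1)[where y = "norm (x + 0 *\<^sub>R e)"]
        isCont_tendsto_compose[where g = norm] tendsto_intros filterlim_ident) auto
    then have "eventually (\<lambda>t. \<psi> (x + t *\<^sub>R e) = 0) (nhds (0::real))"
      by eventually_elim (use supp in auto)
    then have "((\<lambda>t. 0) has_real_derivative D x) (at 0)"
      using deriv[of x] by (subst (asm) DERIV_cong_ev[OF refl _ refl, where g = "\<lambda>_. 0"])
    then show ?thesis
      by (metis DERIV_const DERIV_unique)
  qed
  obtain K where K: "K \<ge> 0" "\<And>x. \<bar>D x\<bar> \<le> K"
    using continuous_compact_support_bounded[OF D D_supp] by blast
  obtain L where L: "L \<ge> 0" "\<And>x. \<bar>\<psi> x\<bar> \<le> L"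
    using continuous_compact_support_bounded[OF \<psi> supp] by blast
  have C: "C \<ge> 0" using g_bd[of 0] by linarith
  have deriv': "((\<lambda>t. \<psi> (x + t *\<^sub>R e)) has_real_derivative D (x + t *\<^sub>R e)) (at t)" for x t
    using deriv[of "x + t *\<^sub>R e"]
      DERIV_shift[of "\<lambda>t. \<psi> (x + t *\<^sub>R e)" "D (x + t *\<^sub>R e)" 0 t]
    by (simp add: algebra_simps)
  \<comment> \<open>The mean value bound makes all difference quotients of \<open>\<psi>\<close> at
    most K in size, which is the domination needed below.\<close>
  have lip: "\<bar>\<psi> (x + t *\<^sub>R e) - \<psi> x\<bar> \<le> K * \<bar>t\<bar>" for x t
    using field_differentiable_bound[of UNIV "\<lambda>t. \<psi> (x + t *\<^sub>R e)"
        "\<lambda>t. D (x + t *\<^sub>R e)" K t 0] deriv' K(2)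
    by auto
  \<comment> \<open>Step sizes at most 1 keep the supports of all quotients in the one ball of
    radius \<open>R + norm e\<close>, so the dominating function is integrable.\<close>
  define \<tau> where "\<tau> n = inverse (real (Suc n))" for n
  have \<tau>: "\<tau> n > 0" "\<tau> n \<le> 1" for n by (auto simp: \<tau>_def field_simps)
  have \<tau>_lim: "filterlim \<tau> (at 0) sequentially"
    unfolding filterlim_at using LIMSEQ_inverse_real_of_nat \<tau>(1)
    by (simp add: \<tau>_def[abs_def])
  define f where "f n x = g x * ((\<psi> (x + \<tau> n *\<^sub>R e) - \<psi> x) / \<tau> n)" for n x
  have int_g\<psi>: "integrable lborel (\<lambda>x. g x * \<psi> x)"
    using g_bd L supp
    by (intro lborel_integrable_bounded_cball[where R = R and K = "C * L"])
      (auto simp: abs_mult intro!: mult_mono C)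
  have int_shift: "integrable lborel (\<lambda>x. g x * \<psi> (x + t *\<^sub>R e))" for t
  proof (intro lborel_integrable_bounded_cball[where R = "R + \<bar>t\<bar> * norm e" and K = "C * L"])
    fix x :: 'a assume "norm x > R + \<bar>t\<bar> * norm e"
    then have "norm (x + t *\<^sub>R e) > R"
      using norm_diff_ineq[of x "t *\<^sub>R e"] by auto
    then show "g x * \<psi> (x + t *\<^sub>R e) = 0" using supp by simp
  qed (use g_bd L in \<open>auto simp: abs_mult intro!: mult_mono C\<close>)
  have f_int: "(\<integral>x. f n x \<partial>lborel) = 0" for n
  proof -
    have "(\<integral>x. f n x \<partial>lborel)
        = (\<integral>x. (g x * \<psi> (x + \<tau> n *\<^sub>R e) - g x * \<psi> x) / \<tau> n \<partial>lborel)"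
      by (simp add: f_def algebra_simps)
    also have "\<dots> = ((\<integral>x. g x * \<psi> (x + \<tau> n *\<^sub>R e) \<partial>lborel) - (\<integral>x. g x * \<psi> x \<partial>lborel)) / \<tau> n"
      using int_shift int_g\<psi> by simp
    also have "(\<integral>x. g x * \<psi> (x + \<tau> n *\<^sub>R e) \<partial>lborel)
        = (\<integral>x. g (\<tau> n *\<^sub>R e + x) * \<psi> (\<tau> n *\<^sub>R e + x) \<partial>lborel)"
      using g_inv by (simp add: add.commute)
    also have "\<dots> = (\<integral>x. g x * \<psi> x \<partial>lborel)"
      by (rule lborel_integral_translation) measurable
    finally show ?thesis by simp
  qed
  have "(\<lambda>n. \<integral>x. f n x \<partial>lborel) \<longlonglongrightarrow> (\<integral>x. g x * D x \<partial>lborel)"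
  proof (rule integral_dominated_convergence
      [where w = "\<lambda>x. C * K * indicator (cball 0 (R + norm e)) x"])
    show "AE x in lborel. (\<lambda>n. f n x) \<longlonglongrightarrow> g x * D x"
    proof (rule AE_I2)
      fix x
      have "((\<lambda>t. (\<psi> (x + t *\<^sub>R e) - \<psi> x) / t) \<longlongrightarrow> D x) (at 0)"
        using deriv[of x] by (simp add: DERIV_def)
      then show "(\<lambda>n. f n x) \<longlonglongrightarrow> g x * D x"
        unfolding f_def by (intro tendsto_intros filterlim_compose[OF _ \<tau>_lim])
    qed
    show "AE x in lborel. norm (f n x) \<le> C * K * indicator (cball 0 (R + norm e)) x" for n
    proof (rule AE_I2)
      fix x :: 'a
      show "norm (f n x) \<le> C * K * indicator (cball 0 (R + norm e)) x"
      proof (cases "norm x \<le> R + norm e")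
        case True
        have "\<bar>\<psi> (x + \<tau> n *\<^sub>R e) - \<psi> x\<bar> / \<tau> n \<le> K"
          using lip[of x "\<tau> n"] \<tau>[of n] by (simp add: field_simps)
        then have "\<bar>g x\<bar> * (\<bar>\<psi> (x + \<tau> n *\<^sub>R e) - \<psi> x\<bar> / \<tau> n) \<le> C * K"
          using g_bd C \<tau>(1)[of n] by (intro mult_mono) auto
        then show ?thesis
          using True \<tau>(1)[of n] by (simp add: f_def abs_mult)
      next
        case False
        have "\<tau> n * norm e \<le> norm e"
          using \<tau>[of n] by (intro mult_left_le_one_le) (auto intro: less_imp_le)
        then have "norm (x + \<tau> n *\<^sub>R e) > R" "norm x > R"
          using False norm_diff_ineq[of x "\<tau> n *\<^sub>R e"] \<tau>[of n] norm_ge_zero[of e]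
          by (auto simp del: norm_ge_zero)
        then show ?thesis using False supp by (simp add: f_def)
      qed
    qed
    show "integrable lborel (\<lambda>x. C * K * indicator (cball 0 (R + norm e)) x :: real)"
      by (intro integrable_mult_right integrable_real_indicator)
        (use emeasure_lborel_cball_finite[of 0 "R + norm e"] in auto)
  qed (auto simp: f_def)
  then have "(\<integral>x. g x * D x \<partial>lborel) = 0"
    using f_int by (simp add: LIMSEQ_const_iff)
  moreover have "integrable lborel (\<lambda>x. g x * D x)"
    using g_bd K D_supp
    by (intro lborel_integrable_bounded_cball[where R = R and K = "C * K"])
      (auto simp: abs_mult intro!: mult_mono C)
  ultimately show ?thesis
    by (simp add: has_bochner_integral_iff)
qed

section \<open>Smooth functions\<close>

lemma partial_deriv_eq:
  assumes "(f has_derivative f') (at x)"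
  shows "partial_deriv j f x = f' (axis j 1)"
  using frechet_derivative_at[OF assms] by (simp add: partial_deriv_def)

text \<open>A successor level of \<open>C_k\<close> requests differentiability, not continuity, so
  the descent from 1 to 0 uses that differentiable functions are continuous. The product rule needs
  this descent: it leaves undifferentiated factors one level lower.\<close>

lemma C_k_Suc_imp: "C_k (Suc k) f \<Longrightarrow> C_k k f"
proof (induction k arbitrary: f)
  case 0
  then show ?case
    by (auto intro!: differentiable_imp_continuous_on simp: differentiable_on_def
        intro: differentiable_at_withinI)
qed auto

lemma partial_deriv_mult:
  assumes "f differentiable at x" "g differentiable at x"
  shows "partial_deriv j (\<lambda>x. f x * g x) x
    = f x * partial_deriv j g x + partial_deriv j f x * g x"
  using has_derivative_mult[OF assms[THEN frechet_derivative_works[THEN iffD1]]]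
  by (subst partial_deriv_eq, assumption) (simp add: partial_deriv_def)

lemma partial_deriv_add:
  assumes "f differentiable at x" "g differentiable at x"
  shows "partial_deriv j (\<lambda>x. f x + g x) x = partial_deriv j f x + partial_deriv j g x"
  using has_derivative_add[OF assms[THEN frechet_derivative_works[THEN iffD1]]]
  by (subst partial_deriv_eq, assumption) (simp add: partial_deriv_def)

lemma C_k_add: "C_k k f \<Longrightarrow> C_k k g \<Longrightarrow> C_k k (\<lambda>x. f x + g x)"
proof (induction k arbitrary: f g)
  case 0
  then show ?case by (auto intro: continuous_intros)
next
  case (Suc k)
  have "partial_deriv j (\<lambda>x. f x + g x) = (\<lambda>x. partial_deriv j f x + partial_deriv j g x)" for j
    using Suc.prems by (intro ext partial_deriv_add) auto
  then show ?case using Suc by auto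
qed

lemma C_k_mult: "C_k k f \<Longrightarrow> C_k k g \<Longrightarrow> C_k k (\<lambda>x. f x * g x)"
proof (induction k arbitrary: f g)
  case 0
  then show ?case by (auto intro: continuous_intros)
next
  case (Suc k)
  have "partial_deriv j (\<lambda>x. f x * g x)
      = (\<lambda>x. f x * partial_deriv j g x + partial_deriv j f x * g x)" for j
    using Suc.prems by (intro ext partial_deriv_mult) auto
  moreover have "C_k k f" "C_k k g" using Suc.prems C_k_Suc_imp by auto
  ultimately show ?case
    using Suc.prems by (auto intro!: C_k_add Suc.IH)
qed

lemma C_k_const: "C_k k (\<lambda>x. c)"
proof (induction k arbitrary: c)
  case (Suc k)
  have "partial_deriv j (\<lambda>x. c) = (\<lambda>x. 0)" for j :: 'a
    by (intro ext, subst partial_deriv_eq[OF has_derivative_const]) simp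
  then show ?case using Suc by simp
qed simp

lemma has_derivative_nth_diff:
  "((\<lambda>x::real^'n. x $ i - c) has_derivative (\<lambda>h. h $ i)) (at x)"
  by (rule derivative_eq_intros bounded_linear_imp_has_derivative
      bounded_linear_vec_nth | simp)+

lemma partial_deriv_nth_diff:
  "partial_deriv j (\<lambda>x::real^'n. x $ i - c) x = (if i = j then 1 else 0)"
  by (simp add: partial_deriv_eq[OF has_derivative_nth_diff] axis_def)

lemma C_k_nth_diff: "C_k k (\<lambda>x::real^'n. x $ i - c)"
proof (cases k)
  case 0
  then show ?thesis by (auto intro!: continuous_intros)
next
  case (Suc l)
  have "partial_deriv j (\<lambda>x::real^'n. x $ i - c) = (\<lambda>x. if i = j then 1 else 0)" for j
    by (intro ext partial_deriv_nth_diff)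
  then show ?thesis
    unfolding Suc C_k.simps
    by (auto intro: C_k_const differentiableI[OF has_derivative_nth_diff])
qed

lemma C_k_sum: "(\<And>i. i \<in> I \<Longrightarrow> C_k k (f i)) \<Longrightarrow> C_k k (\<lambda>x. \<Sum>i\<in>I. f i x)"
  by (induction I rule: infinite_finite_induct) (auto intro: C_k_const C_k_add)

lemma partial_deriv_compose:
  assumes "(h has_real_derivative h') (at (q x))" "q differentiable at x"
  shows "partial_deriv j (\<lambda>x. h (q x)) x = h' * partial_deriv j q x"
proof -
  have "((\<lambda>x. h (q x)) has_derivative (\<lambda>v. h' * frechet_derivative q (at x) v)) (at x)"
    using has_derivative_compose[OF assms(2)[THEN frechet_derivative_works[THEN iffD1]]
        assms(1)[THEN has_field_derivative_imp_has_derivative]] by simp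
  from partial_deriv_eq[OF this] show ?thesis by (simp add: partial_deriv_def)
qed

text \<open>The outer functions form a family closed under differentiation, with \<open>s\<close>
  giving the index of the derivative. The chain rule then produces another family member times a
  partial derivative of q, so the induction has to run over all indices m at once.\<close>

lemma C_k_compose:
  fixes h :: "'c \<Rightarrow> real \<Rightarrow> real"
  assumes h: "\<And>m t. (h m has_real_derivative h (s m) t) (at t)"
    and q: "\<And>k. C_k k q"
  shows "C_k k (\<lambda>x. h m (q x))"
proof (induction k arbitrary: m)
  case 0
  have "continuous_on UNIV (h m)"
    using h by (meson DERIV_isCont continuous_at_imp_continuous_on)
  then show ?case
    using q[of 0] by (auto intro: continuous_on_compose2[of UNIV "h m"])
next
  case (Suc k)
  have dq: "q differentiable at x" for x using q[of 1] by simp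
  have "partial_deriv j (\<lambda>x. h m (q x)) = (\<lambda>x. h (s m) (q x) * partial_deriv j q x)" for j
    by (intro ext partial_deriv_compose h dq)
  moreover have "C_k k (partial_deriv j q)" for j using q[of "Suc k"] by simp
  moreover have "(\<lambda>x. h m (q x)) differentiable at x" for x
    using differentiable_chain_at[OF dq, of "h m" x] h[of m "q x"]
    unfolding o_def differentiable_def
    by (meson has_field_derivative_imp_has_derivative)
  ultimately show ?case
    by (auto intro!: C_k_mult Suc.IH)
qed

section \<open>Functions flat to infinite order at 0\<close>

definition flat_exp :: "real poly \<Rightarrow> real \<Rightarrow> real"
  where "flat_exp p t = (if t > 0 then poly p (inverse t) * exp (- inverse t) else 0)"

text \<open>With s = 1/t, the t-derivative of p(s) exp(-s) is s^2 (p(s) - p'(s)) exp(-s). Hence the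
  family \<open>flat_exp\<close> is closed under differentiation and can be fed to
  \<open>C_k_compose\<close> with polynomials as indices.\<close>

definition flat_exp_deriv :: "real poly \<Rightarrow> real poly"
  where "flat_exp_deriv p = [:0, 0, 1:] * (p - pderiv p)"

lemma poly_mult_exp_minus_tendsto_0:
  "((\<lambda>s. poly p s * exp (- s)) \<longlongrightarrow> (0::real)) at_top"
proof -
  have "((\<lambda>s. \<Sum>i\<le>degree p. coeff p i * (s ^ i / exp s)) \<longlongrightarrow> (\<Sum>i\<le>degree p. coeff p i * 0)) at_top"
    by (intro tendsto_intros tendsto_power_div_exp_0)
  then show ?thesis
    by (simp add: poly_altdef exp_minus sum_distrib_right divide_inverse mult.assoc)
qed

lemma DERIV_flat_exp: "(flat_exp p has_real_derivative flat_exp (flat_exp_deriv p) t) (at t)"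
proof -
  consider "t < 0" | "t = 0" | "t > 0" by linarith
  then show ?thesis
  proof cases
    case 1
    have "(flat_exp p has_real_derivative 0) (at t)"
      by (rule has_field_derivative_transform_within_open[OF DERIV_const[of 0], where S = "{..<0}"])
        (use 1 in \<open>auto simp: flat_exp_def\<close>)
    with 1 show ?thesis by (simp add: flat_exp_def)
  next
    case 3
    have inv: "(inverse has_real_derivative - (inverse t)\<^sup>2) (at t)"
      using 3 DERIV_inverse[of t UNIV] by (simp add: power2_eq_square)
    have "((\<lambda>t. poly p (inverse t)) has_real_derivative
        poly (pderiv p) (inverse t) * - (inverse t)\<^sup>2) (at t)"
      by (rule DERIV_chain2[OF poly_DERIV inv])
    moreover have "((\<lambda>t. exp (- inverse t)) has_real_derivative
        exp (- inverse t) * - (- (inverse t)\<^sup>2)) (at t)"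
      by (rule DERIV_chain2[OF DERIV_exp DERIV_minus[OF inv]])
    ultimately have "((\<lambda>t. poly p (inverse t) * exp (- inverse t)) has_real_derivative
        flat_exp (flat_exp_deriv p) t) (at t)"
      by (rule DERIV_cong[OF DERIV_mult])
        (use 3 in \<open>simp add: flat_exp_def flat_exp_deriv_def algebra_simps power2_eq_square\<close>)
    then show ?thesis
      by (rule has_field_derivative_transform_within_open[where S = "{0<..}"])
        (use 3 in \<open>auto simp: flat_exp_def\<close>)
  next
    case 2
    \<comment> \<open>With s = 1/h, the right difference quotient at 0 is s p(s) exp(-s); dividing
      by h accounts for the extra factor \<open>[:0, 1:]\<close>.\<close>
    have "((\<lambda>s. poly ([:0, 1:] * p) s * exp (- s)) \<longlongrightarrow> 0) at_top"
      by (rule poly_mult_exp_minus_tendsto_0)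
    then have "((\<lambda>h. poly ([:0, 1:] * p) (inverse h) * exp (- inverse h)) \<longlongrightarrow> 0) (at_right 0)"
      by (rule filterlim_compose[OF _ filterlim_inverse_at_top_right])
    then have "((\<lambda>h. (flat_exp p h - flat_exp p 0) / h) \<longlongrightarrow> 0) (at_right 0)"
      by (rule Lim_transform_eventually)
        (simp add: eventually_at_filter flat_exp_def divide_inverse mult_ac)
    moreover have "((\<lambda>h. (flat_exp p h - flat_exp p 0) / h) \<longlongrightarrow> 0) (at_left 0)"
      by (rule Lim_transform_eventually[OF tendsto_const])
        (simp add: eventually_at_filter flat_exp_def)
    ultimately have "((\<lambda>h. (flat_exp p h - flat_exp p 0) / h) \<longlongrightarrow> 0) (at 0)"
      by (intro filterlim_split_at)
    then show ?thesis using 2 by (simp add: DERIV_def flat_exp_def)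
  qed
qed

section \<open>Plateau functions\<close>

text \<open>The tent over [0,1] with peak 2 at 1/2. Its area is 1, so its antiderivative climbs to
  exactly 1.\<close>

definition hump :: "real \<Rightarrow> real"
  where "hump t = 4 * max 0 t - 8 * max 0 (t - 1/2) + 4 * max 0 (t - 1)"

text \<open>The antiderivative of \<open>hump\<close>, a $C^1$ step from 0 to 1.\<close>
definition smooth_step :: "real \<Rightarrow> real"
  where "smooth_step t = 2 * (max 0 t)\<^sup>2 - 4 * (max 0 (t - 1/2))\<^sup>2 + 2 * (max 0 (t - 1))\<^sup>2"

lemma DERIV_max_0_square:
  "((\<lambda>t::real. (max 0 t)\<^sup>2) has_real_derivative 2 * max 0 t) (at t)"
proof -
  consider "t < 0" | "t = 0" | "t > 0" by linarith
  then show ?thesis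
  proof cases
    case 1
    have "((\<lambda>t. (max 0 t)\<^sup>2) has_real_derivative 0) (at t)"
      by (rule has_field_derivative_transform_within_open[OF DERIV_const[of 0], where S = "{..<0}"])
        (use 1 in auto)
    with 1 show ?thesis by simp
  next
    case 2
    have "((\<lambda>h::real. max 0 h) \<longlongrightarrow> max 0 0) (at 0)"
      by (intro tendsto_intros)
    then have "((\<lambda>h::real. max 0 h) \<longlongrightarrow> 0) (at 0)" by simp
    then have "((\<lambda>h::real. (max 0 h)\<^sup>2 / h) \<longlongrightarrow> 0) (at 0)"
      by (rule Lim_transform_eventually)
        (auto simp: eventually_at max_def power2_eq_square intro!: exI[of _ 1])
    then show ?thesis using 2 by (simp add: DERIV_def)
  next
    case 3
    have "((\<lambda>t. t\<^sup>2) has_real_derivative 2 * t) (at t)"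
      by (auto intro!: derivative_eq_intros)
    then have "((\<lambda>t. (max 0 t)\<^sup>2) has_real_derivative 2 * t) (at t)"
      by (rule has_field_derivative_transform_within_open[where S = "{0<..}"]) (use 3 in auto)
    then show ?thesis using 3 by simp
  qed
qed

lemma DERIV_smooth_step: "(smooth_step has_real_derivative hump t) (at t)"
proof -
  have shift: "((\<lambda>t. (max 0 (t - c))\<^sup>2) has_real_derivative 2 * max 0 (t - c)) (at t)" for c
    using DERIV_shift[of "\<lambda>t. (max 0 t)\<^sup>2" "2 * max 0 (t - c)" t "- c"]
      DERIV_max_0_square[of "t - c"] by simp
  have "((\<lambda>t. 2 * (max 0 (t - 0))\<^sup>2 - 4 * (max 0 (t - 1/2))\<^sup>2 + 2 * (max 0 (t - 1))\<^sup>2)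
      has_real_derivative
        2 * (2 * max 0 (t - 0)) - 4 * (2 * max 0 (t - 1/2)) + 2 * (2 * max 0 (t - 1))) (at t)"
    by (intro DERIV_add DERIV_diff DERIV_cmult shift)
  then show ?thesis
    by (simp add: smooth_step_def[abs_def] hump_def)
qed

lemma continuous_hump: "continuous_on S hump"
  unfolding hump_def by (intro continuous_intros)

lemma hump_bounds: "0 \<le> hump t" "hump t \<le> 2"
  by (auto simp: hump_def max_def)

lemma hump_pos: "0 < t \<Longrightarrow> t < 1 \<Longrightarrow> 0 < hump t"
  by (auto simp: hump_def max_def)

lemma hump_eq_0: "t \<le> 0 \<or> t \<ge> 1 \<Longrightarrow> hump t = 0"
  by (auto simp: hump_def max_def)

lemma smooth_step_eq: "t \<le> 0 \<Longrightarrow> smooth_step t = 0" "t \<ge> 1 \<Longrightarrow> smooth_step t = 1"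
  by (auto simp: smooth_step_def max_def power2_eq_square algebra_simps)

lemma smooth_step_bounds: "0 \<le> smooth_step t" "smooth_step t \<le> 1"
proof -
  have mono: "smooth_step x \<le> smooth_step y" if "x \<le> y" for x y
    using that
    by (rule DERIV_nonneg_imp_nondecreasing) (metis DERIV_smooth_step hump_bounds(1))
  \<comment> \<open>The comparison points \<open>min t 0\<close> and \<open>max t 1\<close> lie
    where the step is already constant.\<close>
  show "0 \<le> smooth_step t" using mono[of "min t 0" t] smooth_step_eq(1)[of "min t 0"] by simp
  show "smooth_step t \<le> 1" using mono[of t "max t 1"] smooth_step_eq(2)[of "max t 1"] by simp
qed

text \<open>The rise takes place on [0, 1/k] and the fall on [1 - 1/k, 1]. For k = 2 the two flanks
  meet at 1/2, and \<open>plateau 2\<close> serves as the fixed profile u.\<close>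

definition plateau :: "real \<Rightarrow> real \<Rightarrow> real"
  where "plateau k t = smooth_step (k * t) - smooth_step (k * t - k + 1)"

definition plateau_deriv :: "real \<Rightarrow> real \<Rightarrow> real"
  where "plateau_deriv k t = k * (hump (k * t) - hump (k * t - k + 1))"

lemma DERIV_plateau: "(plateau k has_real_derivative plateau_deriv k t) (at t)"
proof -
  have "((\<lambda>t. smooth_step (k * t)) has_real_derivative hump (k * t) * k) (at t)"
    "((\<lambda>t. smooth_step (k * t - k + 1)) has_real_derivative hump (k * t - k + 1) * k) (at t)"
    by (rule DERIV_chain2[OF DERIV_smooth_step]; auto intro!: derivative_eq_intros)+
  then have "((\<lambda>t. smooth_step (k * t) - smooth_step (k * t - k + 1)) has_real_derivative
      hump (k * t) * k - hump (k * t - k + 1) * k) (at t)"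
    by (rule DERIV_diff)
  then show ?thesis by (simp add: plateau_def[abs_def] plateau_deriv_def algebra_simps)
qed

lemma continuous_plateau: "continuous_on S (plateau k)"
  using DERIV_plateau by (meson DERIV_isCont continuous_at_imp_continuous_on)

lemma continuous_plateau_deriv: "continuous_on S (plateau_deriv k)"
  unfolding plateau_deriv_def
  by (intro continuous_intros continuous_on_compose2[OF continuous_hump[of UNIV]]) auto

lemma plateau_bound: "\<bar>plateau k t\<bar> \<le> 1"
  unfolding plateau_def using smooth_step_bounds[of "k * t"] smooth_step_bounds[of "k * t - k + 1"]
  by linarith

lemma plateau_deriv_bound:
  assumes "k \<ge> 0"
  shows "\<bar>plateau_deriv k t\<bar> \<le> 2 * k"
proof -
  have "\<bar>hump (k * t) - hump (k * t - k + 1)\<bar> \<le> 2"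
    using hump_bounds[of "k * t"] hump_bounds[of "k * t - k + 1"] by linarith
  then show ?thesis
    using assms by (simp add: plateau_deriv_def abs_mult mult.commute mult_left_mono)
qed

lemma plateau_eq_0:
  assumes "k \<ge> 1" "t \<le> 0 \<or> t \<ge> 1"
  shows "plateau k t = 0" "plateau_deriv k t = 0"
proof -
  have "(k * t \<le> 0 \<and> k * t - k + 1 \<le> 0) \<or> (k * t \<ge> 1 \<and> k * t - k + 1 \<ge> 1)"
  proof (cases "t \<le> 0")
    case True
    then have "k * t \<le> 0" using assms by (simp add: mult_nonneg_nonpos)
    then show ?thesis using assms by linarith
  next
    case False
    then have "k * t \<ge> k" using assms by simp
    then show ?thesis using assms by linarith
  qed
  then show "plateau k t = 0" "plateau_deriv k t = 0"
    by (auto simp: plateau_def plateau_deriv_def smooth_step_eq hump_eq_0)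
qed

lemma plateau_eq_1:
  assumes "k > 0" "1 / k \<le> t" "t \<le> 1 - 1 / k"
  shows "plateau k t = 1" "plateau_deriv k t = 0"
proof -
  have "k * t \<ge> 1" "k * t - k + 1 \<le> 0"
    using assms by (auto simp: field_simps)
  then show "plateau k t = 1" "plateau_deriv k t = 0"
    by (auto simp: plateau_def plateau_deriv_def smooth_step_eq hump_eq_0)
qed

lemma plateau_2_deriv_pos: "0 < t \<Longrightarrow> t < 1/2 \<Longrightarrow> 0 < plateau_deriv 2 t"
  using hump_pos[of "2 * t"] by (simp add: plateau_deriv_def hump_eq_0)

section \<open>Fields in a coordinate plane\<close>

lemma test_function_C1:
  assumes "\<phi> \<in> test_functions"
  shows "\<phi> differentiable at x" "continuous_on UNIV \<phi>" "continuous_on UNIV (partial_deriv j \<phi>)"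
proof -
  have C: "C_k k \<phi>" for k using assms by (simp add: test_functions_def)
  show "\<phi> differentiable at x" "continuous_on UNIV (partial_deriv j \<phi>)" using C[of 1] by auto
  show "continuous_on UNIV \<phi>" using C[of 0] by simp
qed

lemma test_function_support:
  assumes "\<phi> \<in> test_functions"
  obtains R where "\<And>x. norm x > R \<Longrightarrow> \<phi> x = 0" "\<And>x j. norm x > R \<Longrightarrow> partial_deriv j \<phi> x = 0"
proof -
  have "bounded (closure {x. \<phi> x \<noteq> 0})"
    using assms by (simp add: test_functions_def compact_imp_bounded)
  then have "bounded {x. \<phi> x \<noteq> 0}"
    by (rule bounded_subset[OF _ closure_subset])
  then obtain R where R: "\<forall>x\<in>{x. \<phi> x \<noteq> 0}. norm x \<le> R"
    unfolding bounded_iff by (elim exE)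
  show thesis
  proof
    show zero: "\<phi> x = 0" if "norm x > R" for x
      using R that by force
    show "partial_deriv j \<phi> x = 0" if x: "norm x > R" for x j
    proof -
      have "open {x::real^'a. norm x > R}" by (intro open_Collect_less continuous_intros)
      then have "(\<phi> has_derivative (\<lambda>_. 0)) (at x)"
        by (rule has_derivative_transform_within_open[OF has_derivative_const[of 0]])
          (use x zero in auto)
      then show ?thesis by (simp add: partial_deriv_eq)
    qed
  qed
qed

lemma DERIV_along_axis:
  assumes "\<phi> differentiable at x"
  shows "((\<lambda>t. \<phi> (x + t *\<^sub>R axis j 1)) has_real_derivative partial_deriv j \<phi> x) (at 0)"
proof -
  have d: "(\<phi> has_derivative frechet_derivative \<phi> (at x)) (at (x + 0 *\<^sub>R axis j 1))"
    using frechet_derivative_works[THEN iffD1, OF assms] by simp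
  have "((\<lambda>t. x + t *\<^sub>R axis j 1) has_derivative (\<lambda>t. t *\<^sub>R axis j 1)) (at (0::real))"
    by (auto intro!: derivative_eq_intros)
  from has_derivative_compose[OF this d]
  have "((\<lambda>t. \<phi> (x + t *\<^sub>R axis j 1)) has_derivative
      (\<lambda>t. frechet_derivative \<phi> (at x) (t *\<^sub>R axis j 1))) (at 0)" .
  moreover have "frechet_derivative \<phi> (at x) (t *\<^sub>R axis j 1) = partial_deriv j \<phi> x * t" for t
    using linear_frechet_derivative[OF assms] by (simp add: linear_cmul partial_deriv_def)
  ultimately show ?thesis
    by (simp add: has_field_derivative_def)
qed

text \<open>This is the directional lemma for the product of u(x_j) and \<open>\<phi>\<close>, with
  g collecting the factors that do not depend on x_j. Both terms stay under one integral so that two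
  such identities can be subtracted and their terms without derivatives of \<open>\<phi>\<close>
  cancel pointwise.\<close>

lemma has_bochner_integral_by_parts_axis:
  fixes \<phi> :: "real^'n \<Rightarrow> real"
  assumes \<phi>: "\<phi> \<in> test_functions"
    and g: "g \<in> borel_measurable borel" "\<And>x. \<bar>g x\<bar> \<le> C" "\<And>x t. g (x + t *\<^sub>R axis j 1) = g x"
    and u: "\<And>t. (u has_real_derivative u' t) (at t)" and u': "continuous_on UNIV u'"
  shows "has_bochner_integral lborel
    (\<lambda>x. g x * (u (x $ j) * partial_deriv j \<phi> x + u' (x $ j) * \<phi> x)) 0"
proof -
  obtain R where R: "\<And>x. norm x > R \<Longrightarrow> \<phi> x = 0"
      "\<And>x j. norm x > R \<Longrightarrow> partial_deriv j \<phi> x = 0"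
    by (rule test_function_support[OF \<phi>]) (rule that)
  have uc: "continuous_on UNIV u"
    using u by (meson DERIV_isCont continuous_at_imp_continuous_on)
  have cont: "continuous_on UNIV (\<lambda>x::real^'n. u (x $ j))" "continuous_on UNIV (\<lambda>x::real^'n. u' (x $ j))"
    by (rule continuous_on_compose2[OF uc] continuous_on_compose2[OF u'];
        auto intro: continuous_intros)+
  show ?thesis
  proof (rule has_bochner_integral_directional_derivative[OF g])
    show "continuous_on UNIV (\<lambda>x. u (x $ j) * \<phi> x)"
      "continuous_on UNIV (\<lambda>x. u (x $ j) * partial_deriv j \<phi> x + u' (x $ j) * \<phi> x)"
      using test_function_C1[OF \<phi>] cont by (auto intro!: continuous_on_add continuous_on_mult)
    show "u (x $ j) * \<phi> x = 0" if "norm x > R" for x using R(1) that by simp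
    show "((\<lambda>t. u ((x + t *\<^sub>R axis j 1) $ j) * \<phi> (x + t *\<^sub>R axis j 1)) has_real_derivative
        u (x $ j) * partial_deriv j \<phi> x + u' (x $ j) * \<phi> x) (at 0)" for x
    proof -
      have "((\<lambda>t. u (t + x $ j)) has_real_derivative u' (x $ j)) (at 0)"
        using DERIV_shift[of u "u' (x $ j)" 0 "x $ j"] u by simp
      then have "((\<lambda>t. u ((x + t *\<^sub>R axis j 1) $ j)) has_real_derivative u' (x $ j)) (at 0)"
        by (simp add: add.commute)
      from DERIV_mult[OF this DERIV_along_axis[OF test_function_C1(1)[OF \<phi>]]]
      show ?thesis by (simp add: add.commute mult.commute)
    qed
  qed
qed

definition planar_field ::
    "'n \<Rightarrow> 'n \<Rightarrow> (real^'n \<Rightarrow> real) \<Rightarrow> (real^'n \<Rightarrow> real) \<Rightarrow> real^'n \<Rightarrow> real^'n"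
  where "planar_field a b p q x = p x *\<^sub>R axis a 1 - q x *\<^sub>R axis b 1"

lemma borel_measurable_planar_field:
  assumes [measurable]: "p \<in> borel_measurable borel" "q \<in> borel_measurable borel"
  shows "planar_field a b p q \<in> borel_measurable borel"
  unfolding planar_field_def[abs_def] by measurable

lemma norm_planar_field_le: "norm (planar_field a b p q x) \<le> \<bar>p x\<bar> + \<bar>q x\<bar>"
  unfolding planar_field_def
  using norm_triangle_ineq4[of "p x *\<^sub>R axis a (1::real)" "q x *\<^sub>R axis b 1"] by simp

text \<open>All components except a and b vanish, so the distributional divergence collapses to one
  integral up to sign. The passage from \<open>lebesgue\<close> to \<open>lborel\<close>, where
  integration by parts is available, also happens here.\<close>

lemma
  fixes p q :: "real^'n \<Rightarrow> real"
  assumes [measurable]: "p \<in> borel_measurable borel" "q \<in> borel_measurable borel"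
    and bd: "\<And>x. \<bar>p x\<bar> \<le> K" "\<And>x. \<bar>q x\<bar> \<le> K"
    and supp: "\<And>x. norm x > R \<Longrightarrow> p x = 0" "\<And>x. norm x > R \<Longrightarrow> q x = 0"
    and ab: "a \<noteq> b"
  shows planar_field_L1: "planar_field a b p q \<in> L1_fields"
    and planar_field_div_free_iff: "planar_field a b p q \<in> div_free_fields \<longleftrightarrow>
      (\<forall>\<phi>\<in>test_functions.
        (\<integral>x. p x * partial_deriv a \<phi> x - q x * partial_deriv b \<phi> x \<partial>lborel) = 0)"
proof -
  note [measurable] = borel_measurable_planar_field
  have int: "integrable lborel (planar_field a b p q)"
  proof (rule lborel_integrable_bounded_cball)
    show "norm (planar_field a b p q x) \<le> K + K" for x
      using norm_planar_field_le[of a b p q x] bd[of x] by linarith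
    show "planar_field a b p q x = 0" if "norm x > R" for x
      using supp that by (simp add: planar_field_def)
  qed measurable
  then show L1: "planar_field a b p q \<in> L1_fields"
    by (simp add: L1_fields_def integrable_completion)
  have "(\<Sum>j\<in>UNIV. distribution_deriv j (regular_distribution (\<lambda>x. planar_field a b p q x $ j)) \<phi>)
      = - (\<integral>x. p x * partial_deriv a \<phi> x - q x * partial_deriv b \<phi> x \<partial>lborel)"
    if \<phi>: "\<phi> \<in> test_functions" for \<phi>
  proof -
    have [measurable]: "partial_deriv j \<phi> \<in> borel_measurable borel" for j
      using test_function_C1(3)[OF \<phi>] by (rule borel_measurable_continuous_onI)
    have int': "integrable lborel (\<lambda>x. f x * partial_deriv j \<phi> x)"
      if [measurable]: "f \<in> borel_measurable borel" and f: "\<And>x. \<bar>f x\<bar> \<le> K" for f j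
    proof -
      obtain r where "\<And>x. norm x > r \<Longrightarrow> \<phi> x = 0"
        and r: "\<And>x j. norm x > r \<Longrightarrow> partial_deriv j \<phi> x = 0"
        by (rule test_function_support[OF \<phi>]) (rule that)
      obtain L where L: "L \<ge> 0" "\<And>x. \<bar>partial_deriv j \<phi> x\<bar> \<le> L"
        using continuous_compact_support_bounded[of "partial_deriv j \<phi>" r]
          test_function_C1(3)[OF \<phi>] r by metis
      have "K \<ge> 0" using f[of 0] by linarith
      then show ?thesis
        using f L r
        by (intro lborel_integrable_bounded_cball[where R = r and K = "K * L"])
          (auto simp: abs_mult intro!: mult_mono)
    qed
    have meas: "(\<lambda>x. planar_field a b p q x $ j * partial_deriv j \<phi> x) \<in> borel_measurable lborel" for j
      by (simp add: planar_field_def)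
    let ?I = "\<lambda>j. \<integral>x. planar_field a b p q x $ j * partial_deriv j \<phi> x \<partial>lborel"
    have "(\<Sum>j\<in>UNIV. distribution_deriv j (regular_distribution (\<lambda>x. planar_field a b p q x $ j)) \<phi>)
        = (\<Sum>j\<in>UNIV. - ?I j)"
      unfolding distribution_deriv_def regular_distribution_def
      by (intro sum.cong refl arg_cong[where f = uminus] integral_completion meas)
    also have "\<dots> = (\<Sum>j\<in>{a, b}. - ?I j)"
      by (rule sum.mono_neutral_right) (auto simp: planar_field_def axis_def)
    also have "\<dots> = - (\<integral>x. p x * partial_deriv a \<phi> x \<partial>lborel) + (\<integral>x. q x * partial_deriv b \<phi> x \<partial>lborel)"
      using ab by (simp add: planar_field_def axis_def)
    also have "\<dots> = - (\<integral>x. p x * partial_deriv a \<phi> x - q x * partial_deriv b \<phi> x \<partial>lborel)"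
      using int'[of p a] int'[of q b] bd by simp
    finally show ?thesis .
  qed
  then show "planar_field a b p q \<in> div_free_fields \<longleftrightarrow>
      (\<forall>\<phi>\<in>test_functions.
        (\<integral>x. p x * partial_deriv a \<phi> x - q x * partial_deriv b \<phi> x \<partial>lborel) = 0)"
    using L1 by (auto simp: div_free_fields_def)
qed

text \<open>For every A and e the exceptional set is contained in \<open>S k\<close>, so the size of
  \<open>Fk k\<close> on \<open>S k\<close> never enters. This is what allows the first component to
  grow like k.\<close>

lemma limitin_lm_topology_shrinking_support:
  fixes Fk :: "nat \<Rightarrow> real^'n \<Rightarrow> real^'n"
  assumes Fk: "\<And>k. Fk k \<in> borel_measurable lebesgue" and F: "F \<in> borel_measurable lebesgue"
    and S: "\<And>k. S k \<in> lmeasurable" "(\<lambda>k. measure lebesgue (S k)) \<longlonglongrightarrow> 0"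
    and eq: "\<And>k x. x \<notin> S k \<Longrightarrow> Fk k x = F x"
  shows "limitin lm_topology Fk F sequentially"
  unfolding limitin_lm_topology[OF Fk F]
proof (intro ballI allI impI)
  fix A :: "(real^'n) set" and e :: real assume A: "A \<in> lmeasurable" and "e > 0"
  have "{x \<in> A. norm (Fk k x - F x) > e} \<subseteq> S k" for k
    using eq[of _ k] \<open>e > 0\<close> by force
  then have "measure lebesgue {x \<in> A. norm (Fk k x - F x) > e} \<le> measure lebesgue (S k)" for k
    using S(1) lm_set_lmeasurable[OF A F Fk, of e k]
    by (intro measure_mono_fmeasurable) (auto intro: fmeasurableD)
  then show "(\<lambda>k. measure lebesgue {x \<in> A. norm (Fk k x - F x) > e}) \<longlonglongrightarrow> 0"
    using S(2) by (intro tendsto_sandwich[OF _ _ tendsto_const S(2)]) auto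
qed

text \<open>The bump is exp(-1/q) with q = r^2 - |x - c|^2. By the chain rule its gradient is a
  nonnegative multiple of c - x, so the sign of each partial derivative inside the ball is read off
  from one coordinate.\<close>

lemma radial_bump:
  fixes c :: "real^'n"
  assumes r: "r > 0"
  obtains \<phi> \<theta> where "\<phi> \<in> test_functions"
    "\<And>j x. partial_deriv j \<phi> x = \<theta> x * (c $ j - x $ j)"
    "\<And>x. dist x c < r \<Longrightarrow> \<theta> x > 0" "\<And>x. dist x c \<ge> r \<Longrightarrow> \<theta> x = 0"
proof -
  define q where "q x = r\<^sup>2 - (x - c) \<bullet> (x - c)" for x
  define \<phi> where "\<phi> x = flat_exp 1 (q x)" for x
  define \<theta> where "\<theta> x = 2 * flat_exp (flat_exp_deriv 1) (q x)" for x
  have q_pos: "q x > 0 \<longleftrightarrow> dist x c < r" for x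
  proof -
    have "(dist x c)\<^sup>2 = (x - c) \<bullet> (x - c)"
      by (simp add: dist_norm power2_norm_eq_inner)
    moreover have "r\<^sup>2 \<le> (dist x c)\<^sup>2 \<longleftrightarrow> r \<le> dist x c"
      using r by (intro power_mono_iff) auto
    ultimately show ?thesis by (simp add: q_def flip: not_le)
  qed
  have dq: "(q has_derivative (\<lambda>h. - 2 * ((x - c) \<bullet> h))) (at x)" for x
    unfolding q_def by (auto intro!: derivative_eq_intros simp: inner_commute)
  \<comment> \<open>The inner product is expanded into coordinates so that the closure rules of
    \<open>C_k\<close> for sums, products, constants and coordinate functions apply.\<close>
  have "q = (\<lambda>x. r\<^sup>2 + (- 1) * (\<Sum>i\<in>UNIV. (x $ i - c $ i) * (x $ i - c $ i)))"
    by (simp add: q_def inner_vec_def fun_eq_iff)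
  then have Cq: "C_k k q" for k
    by (elim ssubst) (intro C_k_add C_k_mult C_k_sum C_k_const C_k_nth_diff)
  have "C_k k \<phi>" for k
    unfolding \<phi>_def by (rule C_k_compose[where h = flat_exp, OF DERIV_flat_exp Cq])
  moreover have "compact (closure {x. \<phi> x \<noteq> 0})"
  proof -
    have "{x. \<phi> x \<noteq> 0} \<subseteq> ball c r"
      using q_pos by (auto simp: \<phi>_def flat_exp_def dist_commute split: if_splits)
    then show ?thesis
      using bounded_subset[OF bounded_ball] by (auto simp: compact_closure)
  qed
  ultimately have "\<phi> \<in> test_functions" by (simp add: test_functions_def)
  moreover have "partial_deriv j \<phi> x = \<theta> x * (c $ j - x $ j)" for j x
  proof -
    have "partial_deriv j \<phi> x = flat_exp (flat_exp_deriv 1) (q x) * partial_deriv j q x"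
      unfolding \<phi>_def
      by (rule partial_deriv_compose[OF DERIV_flat_exp]) (use dq differentiable_def in blast)
    also have "partial_deriv j q x = 2 * (c $ j - x $ j)"
      by (simp add: partial_deriv_eq[OF dq] inner_axis)
    finally show ?thesis by (simp add: \<theta>_def)
  qed
  \<comment> \<open>For the constant polynomial 1, \<open>flat_exp_deriv\<close> gives X^2, which is
    positive at 1/q.\<close>
  moreover have "\<theta> x > 0" if "dist x c < r" for x
    using that q_pos[of x] by (simp add: \<theta>_def flat_exp_def flat_exp_deriv_def)
  moreover have "\<theta> x = 0" if "dist x c \<ge> r" for x
    using that q_pos[of x] by (simp add: \<theta>_def flat_exp_def)
  ultimately show thesis using that by blast
qed

section \<open>Slabs of the unit cube\<close>

definition unit_slab :: "'n \<Rightarrow> real \<Rightarrow> real \<Rightarrow> (real^'n) set"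
  where "unit_slab b s t
    = cbox (\<chi> i. if i = b then s else 0) (\<chi> i. if i = b then t else 1)"

lemma measure_unit_slab:
  assumes "s \<le> t"
  shows "measure lborel (unit_slab b s t) = t - s"
proof -
  have "unit_slab b s t \<noteq> {}"
    unfolding unit_slab_def using assms by (simp add: interval_ne_empty_cart)
  then have "measure lborel (unit_slab b s t)
      = (\<Prod>i\<in>UNIV. (if i = b then t else 1) - (if i = b then s else 0))"
    unfolding unit_slab_def by (simp add: content_cbox_cart)
  also have "\<dots> = (\<Prod>i\<in>UNIV. if i = b then t - s else 1)"
    by (intro prod.cong) auto
  finally show ?thesis by simp
qed

lemma mem_unit_slab:
  assumes "0 \<le> s" "t \<le> 1"
  shows "x \<in> unit_slab b s t \<longleftrightarrow> (\<forall>i. x $ i \<in> {0..1}) \<and> x $ b \<in> {s..t}"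
proof
  assume x: "x \<in> unit_slab b s t"
  have "x $ i \<in> {0..1} \<and> (i = b \<longrightarrow> x $ i \<in> {s..t})" for i
    using x[unfolded unit_slab_def mem_box_cart, rule_format, of i] assms by (cases "i = b") auto
  then show "(\<forall>i. x $ i \<in> {0..1}) \<and> x $ b \<in> {s..t}" by blast
next
  assume "(\<forall>i. x $ i \<in> {0..1}) \<and> x $ b \<in> {s..t}"
  then show "x \<in> unit_slab b s t" by (simp add: unit_slab_def mem_box_cart)
qed

section \<open>The vortex fields\<close>

text \<open>In dimension 2 the condition is vacuous and the function is constantly 1. In higher
  dimension it makes the supports bounded while staying invariant under shifts along the axes a and
  b.\<close>

definition cross_section :: "'n \<Rightarrow> 'n \<Rightarrow> real^'n \<Rightarrow> real"
  where "cross_section a b = indicator {x. \<forall>i. i \<noteq> a \<longrightarrow> i \<noteq> b \<longrightarrow> x $ i \<in> {0..1}}"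

text \<open>The factor \<open>1 / 8\<close> puts the fields into the unit ball.\<close>
definition vortex :: "'n \<Rightarrow> 'n \<Rightarrow> real \<Rightarrow> real^'n \<Rightarrow> real^'n"
  where "vortex a b k = planar_field a b
    (\<lambda>x. cross_section a b x / 8 * (plateau 2 (x $ a) * plateau_deriv k (x $ b)))
    (\<lambda>x. cross_section a b x / 8 * (plateau_deriv 2 (x $ a) * plateau k (x $ b)))"

definition cut_vortex :: "'n \<Rightarrow> 'n \<Rightarrow> real^'n \<Rightarrow> real^'n"
  where "cut_vortex a b = planar_field a b (\<lambda>x. 0)
    (\<lambda>x. cross_section a b x / 8 * (plateau_deriv 2 (x $ a) * indicator {0..1} (x $ b)))"

lemma borel_measurable_plateau [measurable]:
  "plateau k \<in> borel_measurable borel" "plateau_deriv k \<in> borel_measurable borel"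
  using continuous_plateau continuous_plateau_deriv
  by (auto intro: borel_measurable_continuous_onI)

lemma borel_measurable_nth [measurable]: "(\<lambda>x::real^'n. x $ i) \<in> borel_measurable borel"
  by (intro borel_measurable_continuous_onI continuous_intros)

lemma borel_measurable_cross_section [measurable]:
  fixes a b :: "'n::finite"
  shows "cross_section a b \<in> borel_measurable borel"
proof -
  have "closed {x::real^'n. \<forall>i. i \<noteq> a \<longrightarrow> i \<noteq> b \<longrightarrow> x $ i \<in> {0..1}}"
    unfolding atLeastAtMost_iff
    by (intro closed_Collect_all closed_Collect_imp closed_Collect_conj closed_Collect_le
        open_Collect_const continuous_intros)
  then show ?thesis
    unfolding cross_section_def by (intro borel_measurable_indicator) (rule borel_closed)
qed

lemma cross_section_bounds: "0 \<le> cross_section a b x" "cross_section a b x \<le> 1"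
  by (auto simp: cross_section_def indicator_def)

lemma shift_axis_nth: "i \<noteq> j \<Longrightarrow> (x + t *\<^sub>R axis j 1) $ i = x $ i" for x :: "real^'n"
  by (simp add: axis_def)

lemma cross_section_shift:
  "cross_section a b (x + t *\<^sub>R axis a 1) = cross_section a b x"
  "cross_section a b (x + t *\<^sub>R axis b 1) = cross_section a b x"
  by (auto simp: cross_section_def axis_def indicator_def)

lemma outside_unit_cube:
  assumes "\<not> (\<forall>i. x $ i \<in> {0..1})"
  shows "cross_section a b x = 0 \<or> x $ a \<notin> {0..1} \<or> x $ b \<notin> {0..1}"
  using assms unfolding cross_section_def indicator_def by auto

lemma norm_unit_cube_le:
  fixes x :: "real^'n"
  assumes "\<forall>i. x $ i \<in> {0..1}"
  shows "norm x \<le> real CARD('n)"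
proof -
  have "norm x \<le> (\<Sum>i\<in>UNIV. \<bar>x $ i\<bar>)" by (rule norm_le_l1_cart)
  also have "\<dots> \<le> (\<Sum>i\<in>(UNIV::'n set). 1)" using assms by (intro sum_mono) auto
  finally show ?thesis by simp
qed

lemma abs_eighth_product_le:
  fixes c d e :: real
  assumes "0 \<le> c" "c \<le> 1" "\<bar>d\<bar> \<le> D" "\<bar>e\<bar> \<le> E"
  shows "\<bar>c / 8 * (d * e)\<bar> \<le> D * E / 8"
proof -
  have "c * (\<bar>d\<bar> * \<bar>e\<bar>) \<le> 1 * (D * E)"
    using assms by (intro mult_mono) auto
  then show ?thesis using assms by (simp add: abs_mult)
qed

lemma cross_section_product_vanishes:
  assumes "\<not> (\<forall>i. x $ i \<in> {0..1})"
    and "\<And>t. t \<notin> {0..1} \<Longrightarrow> f t = 0" "\<And>t. t \<notin> {0..1} \<Longrightarrow> g t = 0"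
  shows "cross_section a b x / 8 * (f (x $ a) * g (x $ b)) = 0"
  using outside_unit_cube[OF assms(1), of a b] assms(2,3) by auto

lemma plateau_outside:
  assumes "k \<ge> 1" "t \<notin> {0..1}"
  shows "plateau k t = 0" "plateau_deriv k t = 0"
  using plateau_eq_0[OF assms(1), of t] assms(2) by auto

section \<open>Estimates and weak divergence for a fixed steepness k\<close>

context
  fixes a b :: "'n::finite" and k :: real
  assumes ab: "a \<noteq> b" and k: "k \<ge> 2"
begin

private abbreviation (input) p where
  "p \<equiv> \<lambda>x::real^'n. cross_section a b x / 8 * (plateau 2 (x $ a) * plateau_deriv k (x $ b))"
private abbreviation (input) q where
  "q \<equiv> \<lambda>x::real^'n. cross_section a b x / 8 * (plateau_deriv 2 (x $ a) * plateau k (x $ b))"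
private abbreviation (input) q0 where
  "q0 \<equiv> \<lambda>x::real^'n. cross_section a b x / 8 * (plateau_deriv 2 (x $ a) * indicator {0..1} (x $ b))"

lemma vortex_coeff_bounds: "\<bar>p x\<bar> \<le> k / 4" "\<bar>q x\<bar> \<le> 1 / 2" "\<bar>q0 x\<bar> \<le> 1 / 2"
proof -
  note c = cross_section_bounds[of a b x]
  show "\<bar>p x\<bar> \<le> k / 4"
    using abs_eighth_product_le[OF c plateau_bound plateau_deriv_bound[of k]] k by simp
  show "\<bar>q x\<bar> \<le> 1 / 2"
    using abs_eighth_product_le[OF c plateau_deriv_bound[of 2] plateau_bound[of k]] by simp
  show "\<bar>q0 x\<bar> \<le> 1 / 2"
    using abs_eighth_product_le[OF c plateau_deriv_bound[of 2], where e = "indicator {0..1} (x $ b)" and E = 1]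
    by (simp add: indicator_def)
qed

lemma vortex_coeff_outside:
  assumes "\<not> (\<forall>i. x $ i \<in> {0..1})"
  shows "p x = 0" "q x = 0" "q0 x = 0"
  using assms k plateau_outside[of 2] plateau_outside[of k]
  by (intro cross_section_product_vanishes; simp)+

lemma vortex_coeff_supp:
  assumes "norm x > real CARD('n)"
  shows "p x = 0" "q x = 0" "q0 x = 0"
  using vortex_coeff_outside[of x] norm_unit_cube_le[of x] assms by force+

text \<open>Integrating by parts along a, with the derivative of v_k at x_b as a frozen factor, and
  along b, with the derivative of u at x_a frozen, gives two vanishing integrals whose difference is
  the weak divergence up to sign.\<close>

lemma vortex_L1: "vortex a b k \<in> L1_fields"
  and vortex_div_free: "vortex a b k \<in> div_free_fields"
proof -
  \<comment> \<open>The planar lemmas take one bound for both coefficients; \<open>k / 4\<close>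
    serves because k is at least 2.\<close>
  have bd: "\<bar>p x\<bar> \<le> k / 4" "\<bar>q x\<bar> \<le> k / 4" for x
    using vortex_coeff_bounds[of x] k by linarith+
  have meas: "p \<in> borel_measurable borel" "q \<in> borel_measurable borel"
    by measurable
  show "vortex a b k \<in> L1_fields"
    unfolding vortex_def
    by (rule planar_field_L1[OF meas bd vortex_coeff_supp(1,2) ab])
  have div_free_iff: "vortex a b k \<in> div_free_fields \<longleftrightarrow> (\<forall>\<phi>\<in>test_functions.
      (\<integral>x. p x * partial_deriv a \<phi> x - q x * partial_deriv b \<phi> x \<partial>lborel) = 0)"
    unfolding vortex_def
    by (rule planar_field_div_free_iff[OF meas bd vortex_coeff_supp(1,2) ab])
  show "vortex a b k \<in> div_free_fields"
    unfolding div_free_iff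
  proof
    fix \<phi> :: "real^'n \<Rightarrow> real" assume \<phi>: "\<phi> \<in> test_functions"
    \<comment> \<open>The factor 1 gives the expression the shape expected by
      \<open>abs_eighth_product_le\<close>.\<close>
    have bound_b: "\<bar>cross_section a b x / 8 * (1 * plateau_deriv k (x $ b))\<bar> \<le> k / 4" for x
      using abs_eighth_product_le[OF cross_section_bounds[of a b x], of 1 1, OF _ plateau_deriv_bound] k
      by simp
    have bound_a: "\<bar>cross_section a b x / 8 * (1 * plateau_deriv 2 (x $ a))\<bar> \<le> 1 / 2" for x
      using abs_eighth_product_le[OF cross_section_bounds[of a b x], of 1 1, OF _ plateau_deriv_bound[of 2]]
      by simp
    have "has_bochner_integral lborel (\<lambda>x. cross_section a b x / 8 * (1 * plateau_deriv k (x $ b)) *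
        (plateau 2 (x $ a) * partial_deriv a \<phi> x + plateau_deriv 2 (x $ a) * \<phi> x)) 0"
      using bound_b ab
      by (intro has_bochner_integral_by_parts_axis[OF \<phi> _ _ _ DERIV_plateau continuous_plateau_deriv,
          where C = "k / 4"])
        (auto simp: cross_section_shift shift_axis_nth simp del: vector_add_component)
    moreover have "has_bochner_integral lborel (\<lambda>x. cross_section a b x / 8 * (1 * plateau_deriv 2 (x $ a)) *
        (plateau k (x $ b) * partial_deriv b \<phi> x + plateau_deriv k (x $ b) * \<phi> x)) 0"
      using bound_a ab
      by (intro has_bochner_integral_by_parts_axis[OF \<phi> _ _ _ DERIV_plateau continuous_plateau_deriv,
          where C = "1 / 2"])
        (auto simp: cross_section_shift shift_axis_nth simp del: vector_add_component)
    ultimately have "has_bochner_integral lborel (\<lambda>x.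
          cross_section a b x / 8 * (1 * plateau_deriv k (x $ b)) *
            (plateau 2 (x $ a) * partial_deriv a \<phi> x + plateau_deriv 2 (x $ a) * \<phi> x)
        - cross_section a b x / 8 * (1 * plateau_deriv 2 (x $ a)) *
            (plateau k (x $ b) * partial_deriv b \<phi> x + plateau_deriv k (x $ b) * \<phi> x)) (0 - 0)"
      by (rule has_bochner_integral_diff)
    \<comment> \<open>The terms containing both derivatives of the profiles times
      \<open>\<phi>\<close> occur once with each sign and cancel.\<close>
    also have "(\<lambda>x.
          cross_section a b x / 8 * (1 * plateau_deriv k (x $ b)) *
            (plateau 2 (x $ a) * partial_deriv a \<phi> x + plateau_deriv 2 (x $ a) * \<phi> x)
        - cross_section a b x / 8 * (1 * plateau_deriv 2 (x $ a)) *
            (plateau k (x $ b) * partial_deriv b \<phi> x + plateau_deriv k (x $ b) * \<phi> x))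
        = (\<lambda>x. p x * partial_deriv a \<phi> x - q x * partial_deriv b \<phi> x)"
      by (simp add: fun_eq_iff field_simps)
    finally have "has_bochner_integral lborel
        (\<lambda>x. p x * partial_deriv a \<phi> x - q x * partial_deriv b \<phi> x) 0"
      by simp
    then show "(\<integral>x. p x * partial_deriv a \<phi> x - q x * partial_deriv b \<phi> x \<partial>lborel) = 0"
      by (simp add: has_bochner_integral_iff)
  qed
qed

text \<open>Inside the cube but off the two flank slabs the plateau is constantly 1, hence agrees
  with the indicator and has derivative 0. Outside the cube every coefficient vanishes.\<close>

lemma vortex_eq_cut_vortex:
  assumes "x \<notin> unit_slab b 0 (1 / k) \<union> unit_slab b (1 - 1 / k) 1"
  shows "p x = 0" "vortex a b k x = cut_vortex a b x"
proof -
  have "p x = 0 \<and> q x = q0 x"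
  proof (cases "\<forall>i. x $ i \<in> {0..1}")
    case True
    then have "1 / k \<le> x $ b" "x $ b \<le> 1 - 1 / k"
      using assms k by (auto simp: mem_unit_slab)
    with True show ?thesis using plateau_eq_1[of k "x $ b"] k by simp
  next
    case False
    show ?thesis by (simp only: vortex_coeff_outside[OF False])
  qed
  then show "p x = 0" "vortex a b k x = cut_vortex a b x"
    by (auto simp: vortex_def cut_vortex_def planar_field_def)
qed

text \<open>The first component is at most \<open>k / 4\<close> on two slabs of measure 1/k and
  contributes 1/2; the second is at most 1/2 on the unit cube and contributes another 1/2. Without
  the normalisation each share would be 4, which explains the factor 1/8.\<close>

lemma vortex_L1_norm: "L1_norm (vortex a b k) \<le> 1"
proof -
  let ?B = "\<lambda>x. k / 4 * (indicator (unit_slab b 0 (1 / k)) x + indicator (unit_slab b (1 - 1 / k) 1) x)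
    + 1 / 2 * indicator (unit_slab b 0 1) x :: real"
  have slab: "unit_slab b s t \<in> sets lborel" "emeasure lborel (unit_slab b s t) < \<infinity>" for s t
    unfolding unit_slab_def using emeasure_lborel_cbox_finite by auto
  have int: "integrable lborel (indicator (unit_slab b s t) :: _ \<Rightarrow> real)" for s t
    using slab by (intro integrable_real_indicator)
  have "norm (vortex a b k x) \<le> ?B x" for x
  proof -
    have "norm (vortex a b k x) \<le> \<bar>p x\<bar> + \<bar>q x\<bar>"
      unfolding vortex_def by (rule norm_planar_field_le)
    moreover have "\<bar>p x\<bar> \<le> k / 4 * (indicator (unit_slab b 0 (1 / k)) x + indicator (unit_slab b (1 - 1 / k) 1) x)"
    proof (cases "x \<in> unit_slab b 0 (1 / k) \<union> unit_slab b (1 - 1 / k) 1")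
      case True
      then have "1 \<le> (indicator (unit_slab b 0 (1 / k)) x + indicator (unit_slab b (1 - 1 / k) 1) x :: real)"
        by (auto simp: indicator_def)
      then have "k / 4 * 1 \<le> k / 4 * (indicator (unit_slab b 0 (1 / k)) x + indicator (unit_slab b (1 - 1 / k) 1) x)"
        using k by (intro mult_left_mono) auto
      then show ?thesis using vortex_coeff_bounds(1)[of x] by linarith
    next
      case False
      then show ?thesis using vortex_eq_cut_vortex(1)[OF False] by (simp add: indicator_def)
    qed
    moreover have "\<bar>q x\<bar> \<le> 1 / 2 * indicator (unit_slab b 0 1) x"
      using vortex_coeff_bounds(2)[of x] vortex_coeff_outside(2)[of x]
        mem_unit_slab[of 0 1 x b] by (auto simp: indicator_def)
    ultimately show ?thesis by linarith
  qed
  moreover have meas: "vortex a b k \<in> borel_measurable borel"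
    unfolding vortex_def by (intro borel_measurable_planar_field) measurable
  then have "integrable lborel (vortex a b k)"
    using vortex_L1 by (simp add: L1_fields_def integrable_completion)
  ultimately have "(\<integral>x. norm (vortex a b k x) \<partial>lborel) \<le> (\<integral>x. ?B x \<partial>lborel)"
    using int by (intro integral_mono) auto
  also have "\<dots> = k / 4 * (1 / k + 1 / k) + 1 / 2"
    using int measure_unit_slab[of 0 "1 / k" b] measure_unit_slab[of "1 - 1 / k" 1 b]
      measure_unit_slab[of 0 1 b] k slab(1) by simp
  also have "\<dots> = 1" using k by (simp add: field_simps)
  finally have "(\<integral>x. norm (vortex a b k x) \<partial>lborel) \<le> 1" .
  moreover have "L1_norm (vortex a b k) = (\<integral>x. norm (vortex a b k x) \<partial>lborel)"
    unfolding L1_norm_def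
    by (rule integral_completion) (use meas in simp)
  ultimately show ?thesis by simp
qed

lemma cut_vortex_L1: "cut_vortex a b \<in> L1_fields"
  and cut_vortex_not_div_free: "cut_vortex a b \<notin> div_free_fields"
proof -
  have meas: "(\<lambda>x. 0::real) \<in> borel_measurable borel" "q0 \<in> borel_measurable borel"
    by measurable
  have bd: "\<bar>0::real\<bar> \<le> 1 / 2" by simp
  show "cut_vortex a b \<in> L1_fields"
    unfolding cut_vortex_def
    by (rule planar_field_L1[OF meas bd vortex_coeff_bounds(3) refl vortex_coeff_supp(3) ab])
  have div_free_iff: "cut_vortex a b \<in> div_free_fields \<longleftrightarrow> (\<forall>\<phi>\<in>test_functions.
      (\<integral>x. 0 * partial_deriv a \<phi> x - q0 x * partial_deriv b \<phi> x \<partial>lborel) = 0)"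
    unfolding cut_vortex_def
    by (rule planar_field_div_free_iff[OF meas bd vortex_coeff_bounds(3) refl vortex_coeff_supp(3) ab])
  \<comment> \<open>With radius 1/4, the choice 1/4 for x_a keeps the open ball in 0 < x_a < 1/2,
    where u increases; 1 for x_b puts the centre on the face; and 1/2 elsewhere keeps the ball where
    \<open>cross_section\<close> is 1.\<close>
  define c :: "real^'n" where "c = (\<chi> i. if i = a then 1 / 4 else if i = b then 1 else 1 / 2)"
  obtain \<phi> \<theta> where \<phi>: "\<phi> \<in> test_functions"
    and d\<phi>: "\<And>j x. partial_deriv j \<phi> x = \<theta> x * (c $ j - x $ j)"
    and \<theta>: "\<And>x. dist x c < 1 / 4 \<Longrightarrow> \<theta> x > 0" "\<And>x. dist x c \<ge> 1 / 4 \<Longrightarrow> \<theta> x = 0"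
    by (rule radial_bump[of "1 / 4" c]) (simp, rule that)
  let ?f = "\<lambda>x. q0 x * partial_deriv b \<phi> x"
  have near: "c $ i - 1 / 4 < x $ i \<and> x $ i < c $ i + 1 / 4" if "dist x c < 1 / 4" for x i
  proof -
    have "\<bar>x $ i - c $ i\<bar> < 1 / 4"
      using that component_le_norm_cart[of "x - c" i] by (simp add: dist_norm)
    then show ?thesis unfolding abs_diff_less_iff .
  qed
  have pos: "plateau_deriv 2 (x $ a) > 0" if "dist x c < 1 / 4" for x
    using near[OF that, of a] by (intro plateau_2_deriv_pos) (auto simp: c_def)
  have nonneg: "?f x \<ge> 0" for x
  proof (cases "dist x c < 1 / 4 \<and> x $ b \<in> {0..1}")
    case True
    then have "0 \<le> plateau_deriv 2 (x $ a)" "0 \<le> \<theta> x" "0 \<le> c $ b - x $ b"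
      using pos[of x] \<theta>(1)[of x] ab by (auto simp: c_def)
    then show ?thesis
      unfolding d\<phi> using cross_section_bounds(1)[of a b x] by (intro mult_nonneg_nonneg) auto
  next
    case False
    then show ?thesis using \<theta>(2)[of x] by (auto simp: d\<phi>)
  qed
  \<comment> \<open>The face x_b = 1 is left out because the derivative of the bump in direction b
    vanishes on it.\<close>
  define U where "U = ball c (1 / 4) \<inter> {x. x $ b < 1}"
  have f_pos: "?f x \<noteq> 0" if "x \<in> U" for x
  proof -
    have x: "dist x c < 1 / 4" "x $ b < 1"
      using that by (auto simp: U_def dist_commute)
    have "x $ i \<in> {0..1}" if "i \<noteq> a" "i \<noteq> b" for i
      using near[OF x(1), of i] that by (auto simp: c_def)
    then have "cross_section a b x = 1" by (simp add: cross_section_def)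
    moreover have "x $ b \<in> {0..1}" using near[OF x(1), of b] x(2) ab by (auto simp: c_def)
    ultimately show ?thesis
      using pos[OF x(1)] \<theta>(1)[OF x(1)] x(2) ab by (simp add: d\<phi> c_def)
  qed
  have U: "open U" "U \<noteq> {}"
  proof -
    show "open U"
      unfolding U_def by (intro open_Int open_ball open_Collect_less continuous_intros)
    have "dist c (c - (1 / 8) *\<^sub>R axis b 1) < 1 / 4"
      by (simp add: dist_norm)
    moreover have "(c - (1 / 8) *\<^sub>R axis b 1) $ b < 1"
      using ab by (simp add: c_def axis_def)
    ultimately have "c - (1 / 8) *\<^sub>R axis b 1 \<in> U"
      by (simp add: U_def)
    then show "U \<noteq> {}" by blast
  qed
  show "cut_vortex a b \<notin> div_free_fields"
  proof
    assume "cut_vortex a b \<in> div_free_fields"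
    then have "(\<integral>x. 0 * partial_deriv a \<phi> x - ?f x \<partial>lborel) = 0"
      using div_free_iff \<phi> by blast
    then have int0: "(\<integral>x. ?f x \<partial>lborel) = 0" by simp
    obtain R where R: "\<And>x. norm x > R \<Longrightarrow> \<phi> x = 0" "\<And>x j. norm x > R \<Longrightarrow> partial_deriv j \<phi> x = 0"
      by (rule test_function_support[OF \<phi>]) (rule that)
    obtain L where L: "L \<ge> 0" "\<And>x. \<bar>partial_deriv b \<phi> x\<bar> \<le> L"
      using continuous_compact_support_bounded[of "partial_deriv b \<phi>" R]
        test_function_C1(3)[OF \<phi>] R(2) by metis
    have [measurable]: "partial_deriv b \<phi> \<in> borel_measurable borel"
      using test_function_C1(3)[OF \<phi>] by (rule borel_measurable_continuous_onI)
    have bd_f: "norm (?f x) \<le> 1 / 2 * L" for x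
      unfolding real_norm_def abs_mult[of "q0 x"]
      using vortex_coeff_bounds(3)[of x] L by (intro mult_mono) auto
    have "integrable lborel ?f"
      by (rule lborel_integrable_bounded_cball[OF _ bd_f, where R = R]) (use R in auto)
    \<comment> \<open>A nonnegative integrand with integral 0 vanishes almost everywhere, but this
      one is nonzero on the nonempty open set U, which cannot be negligible.\<close>
    then have "AE x in lborel. ?f x = 0"
      using integral_nonneg_eq_0_iff_AE int0 nonneg by blast
    then have "AE x in lebesgue. ?f x = 0" by (rule AE_completion)
    then have "AE x in lebesgue. x \<notin> U"
      by eventually_elim (use f_pos in blast)
    then have "negligible U"
      using AE_iff_null_sets[of U lebesgue] U(1) by (simp add: negligible_iff_null_sets)
    then show False using open_not_negligible U by blast
  qed
qed

end

text \<open>The fields differ from the limit only on two slabs of total measure at most 2/(k+2). The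
  shift by 2 makes every natural index admissible for the preceding estimates.\<close>

lemma vortex_limit:
  fixes a b :: "'n::finite"
  assumes ab: "a \<noteq> b"
  shows "limitin lm_topology (\<lambda>k. vortex a b (real (k + 2))) (cut_vortex a b) sequentially"
proof (rule limitin_lm_topology_shrinking_support)
  let ?k = "\<lambda>k. real (k + 2)"
  let ?S = "\<lambda>k. unit_slab b 0 (1 / ?k k) \<union> unit_slab b (1 - 1 / ?k k) 1"
  have k: "?k k \<ge> 2" for k by simp
  show "vortex a b (?k k) \<in> borel_measurable lebesgue" for k
    using vortex_L1[OF ab k] by (auto simp: L1_fields_def)
  show "cut_vortex a b \<in> borel_measurable lebesgue"
    using cut_vortex_L1[OF ab k] by (auto simp: L1_fields_def)
  have lm: "unit_slab b s t \<in> lmeasurable" for s t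
    by (simp add: unit_slab_def)
  show "?S k \<in> lmeasurable" for k
    using lm by (intro fmeasurable.Un)
  have meas: "measure lebesgue (unit_slab b s t) = t - s" if "s \<le> t" for s t
    using measure_unit_slab[OF that, of b] by (simp add: unit_slab_def)
  have le: "measure lebesgue (?S k) \<le> 2 / ?k k" for k
  proof -
    have "measure lebesgue (?S k) \<le> measure lebesgue (unit_slab b 0 (1 / ?k k))
        + measure lebesgue (unit_slab b (1 - 1 / ?k k) 1)"
      using lm by (intro measure_Un_le) auto
    also have "\<dots> = 2 / ?k k"
      by (subst (1 2) meas) (auto simp: field_simps)
    finally show ?thesis .
  qed
  have "(\<lambda>k. 2 / ?k k) \<longlonglongrightarrow> 0" by real_asymp
  then show "(\<lambda>k. measure lebesgue (?S k)) \<longlonglongrightarrow> 0"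
    by (rule tendsto_sandwich[OF _ _ tendsto_const, rotated 2]) (use le in auto)
  show "vortex a b (?k k) x = cut_vortex a b x" if "x \<notin> ?S k" for k x
    using vortex_eq_cut_vortex(2)[OF ab k that] .
qed

theorem proposition7:
  assumes "CARD('n::finite) > 1"
  shows "\<not> nicely_placed (div_free_fields :: (real^'n \<Rightarrow> real^'n) set)"
proof
  assume "nicely_placed (div_free_fields :: (real^'n \<Rightarrow> real^'n) set)"
  then have closed: "closedin (subtopology lm_topology L1_fields)
      {F \<in> div_free_fields :: (real^'n \<Rightarrow> real^'n) set. L1_norm F \<le> 1}"
    by (simp add: nicely_placed_def)
  obtain a b :: 'n where ab: "a \<noteq> b"
    using assms by (metis (full_types) UNIV_I card_le_Suc0_iff_eq finite One_nat_def not_le)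
  have k: "real (k + 2) \<ge> 2" for k by simp
  \<comment> \<open>Closedness is relative to the integrable fields, so the limit itself must be
    integrable; only its divergence fails.\<close>
  have "limitin (subtopology lm_topology L1_fields) (\<lambda>k. vortex a b (real (k + 2)))
      (cut_vortex a b) sequentially"
    using vortex_limit[OF ab] cut_vortex_L1[OF ab k] vortex_L1[OF ab k]
    by (auto simp: limitin_subtopology)
  then have "cut_vortex a b \<in> {F \<in> div_free_fields. L1_norm F \<le> 1}"
    by (rule limitin_closedin[OF _ closed])
      (use vortex_div_free[OF ab k] vortex_L1_norm[OF ab k] in auto)
  then show False
    using cut_vortex_not_div_free[OF ab k] by blast
qed

end
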